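(* Let $a,b\in\mathbb{C}$ with $|a|^2-|b|^2=1$ and let $\phi(z)=\frac{az+b}{\overline{b}z+\overline{a}}$ for $z\in\mathbb{D}$. If $b=0$, then the Berezin range $\mathrm{Ber}(C_\phi)$ of the composition operator $C_\phi$ acting on the Bergman space $A^2(\mathbb{D})$ is convex if and only if $a\in\{1,-1,i,-i\}$.
   Context: $\mathbb{D}$ is the open unit disc in $\mathbb{C}$. $A^2(\mathbb{D})$ is the Hilbert space of holomorphic functions $f$ on $\mathbb{D}$ with $\int_{\mathbb{D}}|f|^2\,dV<\infty$, where $dV$ is normalized area measure, with the $L^2(dV)$ inner product; its reproducing kernel at $w\in\mathbb{D}$ is $k_w(z)=\frac{1}{(1-\overline{w}z)^2}$. The normalized reproducing kernel is $\hat{k}_w=k_w/\|k_w\|$. The composition operator is $C_\phi f=f\circ\phi$. The Berezin range of a bounded operator $T$ on $A^2(\mathbb{D})$ is $\mathrm{Ber}(T)=\{\langle T\hat{k}_w,\hat{k}_w\rangle : w\in\mathbb{D}\}\subseteq\mathbb{C}$. *)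

theory Defs
  imports "HOL-Complex_Analysis.Complex_Analysis"
begin

abbreviation unit_disc :: "complex set" where
  "unit_disc \<equiv> ball 0 1"

(* The measure space is restricted to the disc so that values of functions outside
   the disc are irrelevant, also for measurability. *)
definition disc_measure :: "complex measure" where
  "disc_measure = uniform_measure (restrict_space lborel unit_disc) unit_disc"

definition bergman_space :: "(complex \<Rightarrow> complex) set" where
  "bergman_space =
     {f. f holomorphic_on unit_disc \<and> integrable disc_measure (\<lambda>z. (cmod (f z))\<^sup>2)}"

definition bergman_inner :: "(complex \<Rightarrow> complex) \<Rightarrow> (complex \<Rightarrow> complex) \<Rightarrow> complex" where
  "bergman_inner f g = (\<integral>z. f z * cnj (g z) \<partial>disc_measure)"

definition bergman_norm :: "(complex \<Rightarrow> complex) \<Rightarrow> real" where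
  "bergman_norm f = sqrt (Re (bergman_inner f f))"

definition bergman_kernel :: "complex \<Rightarrow> complex \<Rightarrow> complex" where
  "bergman_kernel w z = 1 / (1 - cnj w * z)\<^sup>2"

definition normalized_kernel :: "complex \<Rightarrow> complex \<Rightarrow> complex" where
  "normalized_kernel w z = bergman_kernel w z / of_real (bergman_norm (bergman_kernel w))"

definition composition_operator ::
    "(complex \<Rightarrow> complex) \<Rightarrow> (complex \<Rightarrow> complex) \<Rightarrow> complex \<Rightarrow> complex" where
  "composition_operator \<phi> f = f \<circ> \<phi>"

(* Meaningful for operators T that are bounded on the Bergman space. *)
definition berezin_range ::
    "((complex \<Rightarrow> complex) \<Rightarrow> complex \<Rightarrow> complex) \<Rightarrow> complex set" where
  "berezin_range T =
     {bergman_inner (T (normalized_kernel w)) (normalized_kernel w) | w. w \<in> unit_disc}"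

lemma space_disc_measure: "space disc_measure = unit_disc"
  by (simp add: disc_measure_def space_restrict_space)

lemma sets_disc_measure: "sets disc_measure = sets (restrict_space lborel unit_disc)"
  by (simp add: disc_measure_def)

lemma emeasure_disc_measure: "emeasure disc_measure unit_disc = 1"
proof -
  have m: "emeasure (restrict_space lborel unit_disc) unit_disc = emeasure lborel unit_disc"
    by (subst emeasure_restrict_space) auto
  have "emeasure lborel unit_disc = ennreal pi"
    using content_ball[of 1 "0::complex"] emeasure_lborel_ball_finite[of "0::complex" 1]
    by (simp add: emeasure_eq_ennreal_measure unit_ball_vol_2)
  moreover have "unit_disc \<in> sets (restrict_space lborel unit_disc)"
    by (simp add: sets_restrict_space_iff)
  ultimately show ?thesis
    unfolding disc_measure_def using m
    by (subst emeasure_uniform_measure) (auto simp: ennreal_divide_self pi_gt_zero)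
qed

lemma bergman_kernel_in_bergman_space:
  assumes "w \<in> unit_disc"
  shows "bergman_kernel w \<in> bergman_space"
proof -
  have ge: "cmod (1 - cnj w * z) \<ge> 1 - cmod w" if "z \<in> unit_disc" for z
  proof -
    have "cmod (cnj w * z) \<le> cmod w"
      using that by (simp add: norm_mult mult_left_le)
    then show ?thesis
      using norm_triangle_ineq2[of 1 "cnj w * z"] by simp
  qed
  have pos: "1 - cmod w > 0" using assms by simp
  have nz: "1 - cnj w * z \<noteq> 0" if "z \<in> unit_disc" for z
    using ge[OF that] pos by auto
  have hol: "bergman_kernel w holomorphic_on unit_disc"
    unfolding bergman_kernel_def using nz by (intro holomorphic_intros) auto
  have "integrable disc_measure (\<lambda>z. (cmod (bergman_kernel w z))\<^sup>2)"
  proof (rule finite_measure.integrable_const_bound[where B = "(1 / (1 - cmod w)\<^sup>2)\<^sup>2"])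
    show "finite_measure disc_measure"
      by (rule finite_measureI) (simp add: space_disc_measure emeasure_disc_measure)
    show "AE z in disc_measure. norm ((cmod (bergman_kernel w z))\<^sup>2) \<le> (1 / (1 - cmod w)\<^sup>2)\<^sup>2"
    proof (rule AE_I2)
      fix z assume "z \<in> space disc_measure"
      then have z: "z \<in> unit_disc" by (simp add: space_disc_measure)
      have "cmod (bergman_kernel w z) \<le> 1 / (1 - cmod w)\<^sup>2"
        unfolding bergman_kernel_def norm_divide norm_power norm_one
        using ge[OF z] pos by (intro divide_left_mono power_mono mult_pos_pos zero_less_power) auto
      then show "norm ((cmod (bergman_kernel w z))\<^sup>2) \<le> (1 / (1 - cmod w)\<^sup>2)\<^sup>2"
        by (simp add: power_mono del: power_divide)
    qed
    have "continuous_on unit_disc (\<lambda>z. (cmod (bergman_kernel w z))\<^sup>2)"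
      by (intro continuous_intros holomorphic_on_imp_continuous_on hol)
    then have "(\<lambda>z. (cmod (bergman_kernel w z))\<^sup>2) \<in> borel_measurable (restrict_space borel unit_disc)"
      by (rule borel_measurable_continuous_on_restrict)
    then show "(\<lambda>z. (cmod (bergman_kernel w z))\<^sup>2) \<in> borel_measurable disc_measure"
      by (simp add: sets_disc_measure cong: measurable_cong_sets sets_restrict_space_cong)
  qed
  with hol show ?thesis by (simp add: bergman_space_def)
qed

end

theory Submission
  imports Defs "HOL-Probability.Distribution_Functions"
begin

text \<open>
  On the disc \<open>\<phi>\<close> is multiplication by \<open>\<zeta> = a\<^sup>2\<close>, so the reproducing property gives
  \<open>Ber(C\<^sub>\<phi>) = {((1 - t) / (1 - t \<zeta>))\<^sup>2 | 0 \<le> t < 1}\<close>. For \<open>\<zeta> = \<plusminus>1\<close> this is a point or the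
  interval \<open>(0, 1]\<close>. Otherwise the modulus is strictly decreasing along the curve, so if the set
  were convex, every chord starting at the value 1 would contain the part of the curve it cuts off;
  as \<open>t \<rightarrow> 1\<close> the chord tends to \<open>[0, 1]\<close>, and the whole curve would be real.

  The reproducing property \<open>\<langle>f, k\<^sub>w\<rangle> = f(w)\<close> is obtained by averaging the integrand over rotations:
  by Cauchy's formula the mean over the circle through \<open>z\<close> is \<open>d/du (u f(u w))\<close> at \<open>u = |z|\<^sup>2\<close>,
  and \<open>|z|\<^sup>2\<close> is uniformly distributed on \<open>[0, 1]\<close>.
\<close>

section \<open>Rotation invariance of planar Lebesgue measure\<close>

text \<open>Serves to recognise a rotated Lebesgue measure. Fubini yields
  \<open>\<mu>(A) * lborel(B) = lborel(A) * \<mu>(B)\<close> with \<open>B\<close> the unit ball,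
  whose common measure is positive and finite and cancels.\<close>

lemma translation_invariant_eq_lborel:
  fixes \<mu> :: "'a::euclidean_space measure"
  assumes "sigma_finite_measure \<mu>" and sets_eq: "sets \<mu> = sets borel"
    and inv: "\<And>c. distr \<mu> borel ((+) c) = \<mu>"
    and ball: "emeasure \<mu> (ball 0 1) = emeasure lborel (ball 0 1 :: 'a set)"
  shows "\<mu> = lborel"
proof (rule measure_eqI)
  show "sets \<mu> = sets lborel" using sets_eq by simp
  note [measurable_cong] = sets_eq
  interpret sigma_finite_measure \<mu> by fact
  interpret P: pair_sigma_finite \<mu> "lborel :: 'a measure" ..
  fix A assume "A \<in> sets \<mu>"
  then have A[measurable]: "A \<in> sets borel" using sets_eq by simp
  define B :: "'a set" where "B = ball 0 1"
  have B[measurable]: "B \<in> sets borel" by (simp add: B_def)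
  have reflect: "(\<integral>\<^sup>+y. indicator A (x - y) \<partial>lborel) = emeasure lborel A" for x
  proof -
    have "emeasure lborel A = (\<integral>\<^sup>+y. indicator A y \<partial>lborel)" by simp
    \<comment> \<open>The reflection is an affine map with factor \<open>-1\<close>, so its Jacobian
      factor is 1.\<close>
    also have "\<dots> = (\<integral>\<^sup>+y. indicator A y \<partial>density (distr lborel borel (\<lambda>y. x + (-1) *\<^sub>R y)) (\<lambda>_. \<bar>-1::real\<bar> ^ DIM('a)))"
      by (subst lborel_affine[of "-1" x]) auto
    also have "\<dots> = (\<integral>\<^sup>+y. indicator A (x - y) \<partial>lborel)"
      by (subst nn_integral_density) (auto simp: nn_integral_distr simp del: nn_integral_indicator)
    finally show ?thesis by simp
  qed
  have shift: "(\<integral>\<^sup>+y. indicator B (x + y) \<partial>lborel) = emeasure lborel B" for x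
  proof -
    have "emeasure lborel B = (\<integral>\<^sup>+y. indicator B y \<partial>distr lborel borel ((+) x))"
      by (simp add: lborel_distr_plus)
    also have "\<dots> = (\<integral>\<^sup>+y. indicator B (x + y) \<partial>lborel)"
      by (subst nn_integral_distr) auto
    finally show ?thesis by simp
  qed
  have inv': "(\<integral>\<^sup>+x. indicator A x * indicator B (x + y) \<partial>\<mu>) =
      (\<integral>\<^sup>+x. indicator A (x - y) * indicator B x \<partial>\<mu>)" for y
  proof -
    have "(\<integral>\<^sup>+x. indicator A x * indicator B (x + y) \<partial>\<mu>) =
        (\<integral>\<^sup>+x. indicator A x * indicator B (x + y) \<partial>distr \<mu> borel ((+) (-y)))"
      by (simp add: inv)
    also have "\<dots> = (\<integral>\<^sup>+x. indicator A (x - y) * indicator B x \<partial>\<mu>)"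
      by (subst nn_integral_distr) (auto simp: algebra_simps)
    finally show ?thesis .
  qed
  \<comment> \<open>The set of pairs with \<open>x \<in> A\<close>, \<open>x + y \<in> B\<close> is measured by \<open>\<mu> \<times> lborel\<close> in both orders of integration.\<close>
  have "emeasure \<mu> A * emeasure lborel B =
      (\<integral>\<^sup>+x. (\<integral>\<^sup>+y. indicator A x * indicator B (x + y) \<partial>lborel) \<partial>\<mu>)"
    by (simp add: nn_integral_cmult shift nn_integral_multc sets_eq)
  also have "\<dots> = (\<integral>\<^sup>+y. (\<integral>\<^sup>+x. indicator A x * indicator B (x + y) \<partial>\<mu>) \<partial>lborel)"
    by (rule P.Fubini'[symmetric]) measurable
  also have "\<dots> = (\<integral>\<^sup>+y. (\<integral>\<^sup>+x. indicator A (x - y) * indicator B x \<partial>\<mu>) \<partial>lborel)"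
    by (simp add: inv')
  also have "\<dots> = (\<integral>\<^sup>+x. (\<integral>\<^sup>+y. indicator A (x - y) * indicator B x \<partial>lborel) \<partial>\<mu>)"
    by (rule P.Fubini') measurable
  also have "\<dots> = emeasure lborel A * emeasure \<mu> B"
    by (simp add: nn_integral_cmult reflect nn_integral_multc sets_eq)
  finally have "emeasure \<mu> A * emeasure lborel B = emeasure lborel A * emeasure lborel B"
    using ball by (simp add: B_def)
  moreover have "emeasure lborel B \<noteq> 0" "emeasure lborel B \<noteq> top"
    using emeasure_lborel_ball_finite[of "0::'a" 1] content_ball_gt_0_iff[of "0::'a" 1]
    by (auto simp: B_def measure_def simp del: content_ball_gt_0_iff)
  ultimately show "emeasure \<mu> A = emeasure lborel A"
    by (simp add: ennreal_mult_cancel_left mult.commute[of _ "emeasure lborel B"])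
qed

text \<open>Rotating and then translating by \<open>d\<close> equals translating by
  \<open>cnj c * d\<close> and then rotating, so the image measure is again translation invariant.
  Centred balls are preserved, which settles both the normalization and sigma-finiteness.\<close>

lemma distr_lborel_rotation:
  fixes c :: complex
  assumes "cmod c = 1"
  shows "distr lborel borel ((*) c) = lborel"
proof (rule translation_invariant_eq_lborel)
  have c: "c * cnj c = 1" using assms by (simp add: complex_norm_square[symmetric])
  show inv: "distr (distr lborel borel ((*) c)) borel ((+) d) = distr lborel borel ((*) c)" for d
  proof -
    have "distr (distr lborel borel ((*) c)) borel ((+) d) = distr lborel borel ((+) d \<circ> (*) c)"
      by (rule distr_distr) auto
    also have "(+) d \<circ> (*) c = (*) c \<circ> (+) (cnj c * d)"
      using c by (auto simp: fun_eq_iff algebra_simps)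
    also have "distr lborel borel \<dots> = distr (distr lborel borel ((+) (cnj c * d))) borel ((*) c)"
      by (rule distr_distr[symmetric]) auto
    finally show ?thesis by (simp add: lborel_distr_plus)
  qed
  have vimage: "(*) c -` ball 0 r = ball 0 r" for r
    using assms by (auto simp: norm_mult)
  show "emeasure (distr lborel borel ((*) c)) (ball 0 1) = emeasure lborel (ball 0 1 :: complex set)"
    by (simp add: emeasure_distr vimage)
  show "sigma_finite_measure (distr lborel borel ((*) c))"
  proof (rule sigma_finite_measure.intro, intro exI conjI)
    show "countable (range (\<lambda>n. ball (0::complex) (real n)))" by simp
    show "range (\<lambda>n. ball (0::complex) (real n)) \<subseteq> sets (distr lborel borel ((*) c))" by auto
    show "\<Union> (range (\<lambda>n. ball (0::complex) (real n))) = space (distr lborel borel ((*) c))"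
      by (auto simp: reals_Archimedean2)
    show "\<forall>a\<in>range (\<lambda>n. ball (0::complex) (real n)). emeasure (distr lborel borel ((*) c)) a \<noteq> \<infinity>"
      using emeasure_lborel_ball_finite by (auto simp: emeasure_distr vimage less_top)
  qed
qed simp

section \<open>Normalized area measure on the disc: rotations and radial distribution\<close>

lemma emeasure_disc_measure_eq:
  assumes "A \<in> sets borel" "A \<subseteq> unit_disc"
  shows "emeasure disc_measure A = emeasure lborel A / ennreal pi"
proof -
  have d: "emeasure lborel unit_disc = ennreal pi"
    by (simp add: emeasure_ball unit_ball_vol_2)
  have "unit_disc \<in> sets (restrict_space lborel unit_disc)"
    "A \<in> sets (restrict_space lborel unit_disc)"
    using assms by (auto simp: sets_restrict_space_iff)
  then show ?thesis
    unfolding disc_measure_def using assms d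
    by (subst emeasure_uniform_measure) (auto simp: emeasure_restrict_space Int_absorb1)
qed

lemma sets_disc_measure_iff: "A \<in> sets disc_measure \<longleftrightarrow> A \<in> sets borel \<and> A \<subseteq> unit_disc"
  by (auto simp: sets_disc_measure sets_restrict_space_iff)

lemma prob_space_disc_measure: "prob_space disc_measure"
  by (rule prob_spaceI) (simp add: space_disc_measure emeasure_disc_measure)

lemma borel_measurable_disc_measureI:
  "f \<in> borel_measurable (restrict_space borel unit_disc) \<Longrightarrow> f \<in> borel_measurable disc_measure"
  by (simp add: sets_disc_measure cong: measurable_cong_sets sets_restrict_space_cong)

lemma borel_measurable_disc_measure_continuous:
  "continuous_on unit_disc f \<Longrightarrow> f \<in> borel_measurable disc_measure"
  by (intro borel_measurable_disc_measureI borel_measurable_continuous_on_restrict)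

lemma measurable_disc_measure_rotation:
  assumes "cmod c = 1"
  shows "(*) c \<in> measurable disc_measure disc_measure"
proof -
  have "(*) c \<in> measurable (restrict_space borel unit_disc) (restrict_space borel unit_disc)"
    using assms by (intro measurable_restrict_space3) (auto simp: norm_mult)
  then show ?thesis
    by (simp add: sets_disc_measure cong: measurable_cong_sets sets_restrict_space_cong)
qed

lemma distr_disc_measure_rotation:
  assumes "cmod c = 1"
  shows "distr disc_measure disc_measure ((*) c) = disc_measure"
proof (rule measure_eqI)
  fix A assume "A \<in> sets (distr disc_measure disc_measure ((*) c))"
  then have A: "A \<in> sets disc_measure" "A \<in> sets borel" "A \<subseteq> unit_disc"
    by (auto simp: sets_disc_measure_iff)
  have sub: "(*) c -` A \<subseteq> unit_disc"
    using A(3) assms by (fastforce simp: norm_mult)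
  then have eq: "(*) c -` A \<inter> space disc_measure = (*) c -` A"
    by (simp add: space_disc_measure Int_absorb2)
  have meas: "(*) c -` A \<in> sets borel"
    using measurable_sets_borel[of "(*) c" borel A] A(2) by simp
  have "emeasure lborel A = emeasure (distr lborel borel ((*) c)) A"
    using assms by (simp add: distr_lborel_rotation)
  also have "\<dots> = emeasure lborel ((*) c -` A)"
    using A(2) by (simp add: emeasure_distr)
  finally show "emeasure (distr disc_measure disc_measure ((*) c)) A = emeasure disc_measure A"
    using A eq sub meas measurable_disc_measure_rotation[OF assms]
    by (simp add: emeasure_distr emeasure_disc_measure_eq)
qed simp

text \<open>For \<open>0 \<le> x < 1\<close> the set where \<open>|z|\<^sup>2 \<le> x\<close> is a
  closed disc of area \<open>pi * x\<close>, hence of normalized measure \<open>x\<close>; the two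
  distribution functions agree.\<close>

lemma distr_disc_measure_cmod_power2:
  "distr disc_measure borel (\<lambda>z. (cmod z)\<^sup>2) = uniform_measure lborel {0..1::real}"
proof (rule cdf_unique)
  have m: "(\<lambda>z. (cmod z)\<^sup>2) \<in> borel_measurable disc_measure"
    by (intro borel_measurable_disc_measure_continuous continuous_intros)
  interpret D: prob_space disc_measure by (rule prob_space_disc_measure)
  interpret U: prob_space "uniform_measure lborel {0..1::real}"
    by (rule prob_space_uniform_measure) auto
  show "real_distribution (distr disc_measure borel (\<lambda>z. (cmod z)\<^sup>2))"
    using m by (auto intro!: real_distribution.intro D.prob_space_distr real_distribution_axioms.intro)
  show "real_distribution (uniform_measure lborel {0..1::real})"
    by (auto intro!: real_distribution.intro U.prob_space_axioms real_distribution_axioms.intro)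
  show "cdf (distr disc_measure borel (\<lambda>z. (cmod z)\<^sup>2)) = cdf (uniform_measure lborel {0..1::real})"
  proof
    fix x :: real
    have u: "cdf (uniform_measure lborel {0..1::real}) x = measure lborel ({0..1} \<inter> {..x})"
      by (simp add: cdf_def measure_uniform_measure)
    have d: "cdf (distr disc_measure borel (\<lambda>z. (cmod z)\<^sup>2)) x =
        measure disc_measure {z \<in> unit_disc. (cmod z)\<^sup>2 \<le> x}"
      using m by (simp add: cdf_def measure_distr space_disc_measure vimage_def Int_def conj_commute)
    consider "x < 0" | "0 \<le> x" "x < 1" | "1 \<le> x" by linarith
    then show "cdf (distr disc_measure borel (\<lambda>z. (cmod z)\<^sup>2)) x = cdf (uniform_measure lborel {0..1::real}) x"
    proof cases
      case 1
      have "{0..1} \<inter> {..x} = {}" using 1 by auto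
      moreover have "{z \<in> unit_disc. (cmod z)\<^sup>2 \<le> x} = {}"
        using 1 by (auto simp: not_le intro: less_le_trans)
      ultimately show ?thesis unfolding u d by (simp only: measure_empty)
    next
      case 2
      have "{0..1} \<inter> {..x} = {0..x}" using 2 by auto
      moreover have "{z \<in> unit_disc. (cmod z)\<^sup>2 \<le> x} = cball 0 (sqrt x)"
      proof -
        have "cmod z < 1" if "cmod z \<le> sqrt x" for z :: complex
          using that 2 real_sqrt_lt_1_iff[of x] by linarith
        moreover have "(cmod z)\<^sup>2 \<le> x \<longleftrightarrow> cmod z \<le> sqrt x" for z :: complex
          using 2 by (metis norm_ge_zero real_sqrt_le_iff real_sqrt_unique)
        ultimately show ?thesis by auto
      qed
      moreover have "measure disc_measure (cball 0 (sqrt x)) = x"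
      proof -
        have "sqrt x < 1" using 2 by simp
        then have "cball (0::complex) (sqrt x) \<subseteq> unit_disc"
          by (auto simp del: real_sqrt_lt_1_iff)
        then have "emeasure disc_measure (cball 0 (sqrt x)) = ennreal x"
          using 2 by (subst emeasure_disc_measure_eq)
            (auto simp: emeasure_cball unit_ball_vol_2 divide_ennreal)
        then show ?thesis using 2 by (simp add: measure_def)
      qed
      ultimately show ?thesis unfolding u d using 2 by simp
    next
      case 3
      have "{0..1} \<inter> {..x} = {0..1}" using 3 by auto
      moreover have "{z \<in> unit_disc. (cmod z)\<^sup>2 \<le> x} = space disc_measure"
        using 3 by (auto simp: space_disc_measure abs_square_le_1[symmetric] power_le_one order_trans[OF power_le_one])
      ultimately show ?thesis unfolding u d by (simp add: D.prob_space)
    qed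
  qed
qed

section \<open>Circle averages and the reproducing property\<close>

text \<open>Passes from averages against a probability measure to the gauge integral, in which
  Cauchy's formula and the fundamental theorem of calculus are available.\<close>

lemma integral_uniform_measure_Icc:
  fixes g :: "real \<Rightarrow> 'a::euclidean_space"
  assumes "a < b" "g \<in> borel_measurable borel" "continuous_on {a..b} g"
  shows "integral\<^sup>L (uniform_measure lborel {a..b}) g = (1 / (b - a)) *\<^sub>R integral {a..b} g"
proof -
  have "integral\<^sup>L (uniform_measure lborel {a..b}) g =
      integral\<^sup>L (density lborel (\<lambda>x. ennreal (indicator {a..b} x / (b - a)))) g"
    using assms(1) unfolding uniform_measure_def
    by (intro arg_cong2[where f = "integral\<^sup>L"] arg_cong2[where f = density])
      (auto simp: fun_eq_iff indicator_def divide_ennreal[symmetric])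
  also have "\<dots> = (\<integral>x. (indicator {a..b} x / (b - a)) *\<^sub>R g x \<partial>lborel)"
    using assms(1,2) by (intro integral_density) auto
  also have "\<dots> = (\<integral>x. (1 / (b - a)) *\<^sub>R (indicator {a..b} x *\<^sub>R g x) \<partial>lborel)"
    by simp
  also have "\<dots> = (1 / (b - a)) *\<^sub>R (\<integral>x. indicator {a..b} x *\<^sub>R g x \<partial>lborel)"
    by (rule integral_scaleR_right)
  also have "(\<integral>x. indicator {a..b} x *\<^sub>R g x \<partial>lborel) = integral {a..b} g"
    using set_borel_integral_eq_integral(2)[OF borel_integrable_atLeastAtMost'[OF assms(3)]]
    by (simp add: set_lebesgue_integral_def)
  finally show ?thesis .
qed

text \<open>Every rotation preserves the measure, so the integral of
  \<open>F (cis \<theta> * z)\<close> over \<open>z\<close> is the same for all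
  \<open>\<theta>\<close>; average over \<open>\<theta>\<close> and exchange the integrals.\<close>

lemma integral_disc_measure_rotation_average:
  fixes F :: "complex \<Rightarrow> complex"
  assumes F: "integrable disc_measure F"
  shows "integral\<^sup>L disc_measure F =
    (\<integral>z. (\<integral>\<theta>. F (cis \<theta> * z) \<partial>uniform_measure lborel {0..2 * pi}) \<partial>disc_measure)"
proof -
  define U where "U = uniform_measure lborel {0..2 * pi}"
  interpret D: prob_space disc_measure by (rule prob_space_disc_measure)
  interpret U: prob_space U
    unfolding U_def by (rule prob_space_uniform_measure) auto
  interpret P: pair_sigma_finite U disc_measure ..
  have [measurable_cong]: "sets U = sets borel" by (simp add: U_def)
  have id: "(\<lambda>z. z) \<in> borel_measurable disc_measure"
    by (intro borel_measurable_disc_measure_continuous continuous_intros)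
  have cis: "cis \<in> borel_measurable U"
    unfolding U_def measurable_cong_sets[OF sets_uniform_measure refl]
    by (simp, intro borel_measurable_continuous_onI continuous_intros)
  have "(\<lambda>x. cis (fst x) * snd x) \<in> borel_measurable (U \<Otimes>\<^sub>M disc_measure)"
    using id cis by measurable
  \<comment> \<open>The sigma-algebra of \<open>disc_measure\<close> lives on the disc only, so the
    rotated point must also be shown to stay in the disc.\<close>
  then have "(\<lambda>x. cis (fst x) * snd x) \<in> measurable (U \<Otimes>\<^sub>M disc_measure) (restrict_space borel unit_disc)"
    by (intro measurable_restrict_space2) (auto simp: space_pair_measure space_disc_measure norm_mult)
  then have rot: "(\<lambda>x. cis (fst x) * snd x) \<in> measurable (U \<Otimes>\<^sub>M disc_measure) disc_measure"
    by (simp add: sets_disc_measure cong: measurable_cong_sets sets_restrict_space_cong)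
  \<comment> \<open>The codomain is left general because this is applied both to \<open>F\<close>
    and to its real-valued norm.\<close>
  have inv: "(\<integral>z. g (cis \<theta> * z) \<partial>disc_measure) = integral\<^sup>L disc_measure g"
    if "g \<in> borel_measurable disc_measure"
    for \<theta> and g :: "complex \<Rightarrow> 'b::{banach, second_countable_topology}"
    using integral_distr[OF measurable_disc_measure_rotation[of "cis \<theta>"] that]
    by (simp add: distr_disc_measure_rotation)
  \<comment> \<open>By invariance the inner integral of the norm is constant in
    \<open>\<theta>\<close>, hence integrable over the probability measure \<open>U\<close>.\<close>
  have "integrable (U \<Otimes>\<^sub>M disc_measure) (\<lambda>(\<theta>, z). F (cis \<theta> * z))"
  proof (rule P.Fubini_integrable)
    show "(\<lambda>(\<theta>, z). F (cis \<theta> * z)) \<in> borel_measurable (U \<Otimes>\<^sub>M disc_measure)"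
      using measurable_compose[OF rot borel_measurable_integrable[OF F]] by (simp add: case_prod_beta)
    show "integrable U (\<lambda>\<theta>. \<integral>z. norm (case (\<theta>, z) of (\<theta>, z) \<Rightarrow> F (cis \<theta> * z)) \<partial>disc_measure)"
      using F by (simp add: inv[of "\<lambda>z. norm (F z)"])
    show "AE \<theta> in U. integrable disc_measure (\<lambda>z. case (\<theta>, z) of (\<theta>, z) \<Rightarrow> F (cis \<theta> * z))"
      using integrable_distr[OF measurable_disc_measure_rotation, of _ F] F
      by (simp add: distr_disc_measure_rotation)
  qed
  from P.Fubini_integral[OF this]
  have "(\<integral>z. (\<integral>\<theta>. F (cis \<theta> * z) \<partial>U) \<partial>disc_measure) = (\<integral>\<theta>. integral\<^sup>L disc_measure F \<partial>U)"
    using F by (simp add: inv)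
  then show ?thesis by (simp add: U_def[symmetric] U.prob_space)
qed

lemma integral_circle_kernel:
  assumes f: "f holomorphic_on unit_disc" and w: "w \<in> unit_disc" and z: "z \<in> unit_disc"
  shows "(\<integral>\<theta>. f (cis \<theta> * z) * cnj (bergman_kernel w (cis \<theta> * z)) \<partial>uniform_measure lborel {0..2 * pi})
    = f (of_real ((cmod z)\<^sup>2) * w) + of_real ((cmod z)\<^sup>2) * w * deriv f (of_real ((cmod z)\<^sup>2) * w)"
proof -
  \<comment> \<open>On \<open>|u| = 1\<close> the conjugate kernel at \<open>u z\<close> is \<open>u\<^sup>2 / (u - p)\<^sup>2\<close>, so this is Cauchy's formula
    for the derivative of \<open>h\<close> at \<open>p\<close>.\<close>
  define p where "p = w * cnj z"
  \<comment> \<open>The factor \<open>u\<close>, together with the one in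
    \<open>du = \<i> * u * dt\<close>, supplies the numerator \<open>u\<^sup>2\<close>.\<close>
  define h where "h = (\<lambda>u. f (u * z) * u)"
  have pz: "p * z = of_real ((cmod z)\<^sup>2) * w"
    by (simp only: p_def complex_norm_square mult_ac)
  have p: "cmod p < 1"
    using w z by (auto simp: p_def norm_mult intro: mult_le_less_imp_less[of _ 1 _ 1, simplified] le_less_trans[OF mult_left_le])
  have uz: "u * z \<in> unit_disc" if "cmod u \<le> 1" for u
    using z that by (auto simp: norm_mult intro: le_less_trans[OF mult_left_le_one_le])
  \<comment> \<open>This preimage contains the closed unit disc because \<open>|z| < 1\<close>; so
    \<open>h\<close> is holomorphic inside the circle and continuous up to it, as Cauchy's formula
    requires.\<close>
  have hh: "h holomorphic_on (\<lambda>u. u * z) -` unit_disc"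
    unfolding h_def
    by (intro holomorphic_intros holomorphic_on_compose_gen[OF _ f, unfolded o_def]) auto
  have hol: "h holomorphic_on ball 0 1" and cont: "continuous_on (cball 0 1) h"
    by (rule holomorphic_on_subset[OF hh] continuous_on_subset[OF holomorphic_on_imp_continuous_on[OF hh]];
        use uz in force)+
  have "(f has_field_derivative deriv f (p * z)) (at (p * z))"
    using f uz[of p] p by (intro holomorphic_derivI[where S = unit_disc]) auto
  then have "(h has_field_derivative (deriv f (p * z) * z * p + f (p * z))) (at p)"
    unfolding h_def
    by (auto intro!: derivative_eq_intros DERIV_chain2[where f = f and g = "\<lambda>u. u * z"])
  then have dh: "deriv h p = f (p * z) + p * z * deriv f (p * z)"
    by (simp add: DERIV_imp_deriv)
  have "((\<lambda>u. h u / (u - p) ^ Suc 1) has_contour_integral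
      (2 * pi * \<i>) / fact 1 * (deriv ^^ 1) h p) (circlepath 0 1)"
    using p by (intro Cauchy_has_contour_integral_higher_derivative_circlepath cont hol) auto
  then have "((\<lambda>t. h (cis t) / (cis t - p)\<^sup>2 * \<i> * cis t) has_integral 2 * pi * \<i> * deriv h p) {0..2 * pi}"
    by (simp add: circlepath_def has_contour_integral_part_circlepath_iff power2_eq_square)
  then have "((\<lambda>t. 1 / \<i> * (h (cis t) / (cis t - p)\<^sup>2 * \<i> * cis t)) has_integral
      1 / \<i> * (2 * pi * \<i> * deriv h p)) {0..2 * pi}"
    by (rule has_integral_mult_right)
  also have "(\<lambda>t. 1 / \<i> * (h (cis t) / (cis t - p)\<^sup>2 * \<i> * cis t)) =
      (\<lambda>t. f (cis t * z) * cnj (bergman_kernel w (cis t * z)))"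
  proof
    fix t
    have ct: "cnj (cis t) * cis t = 1" by (simp add: cis_cnj cis_mult)
    have ii: "\<i> * (x * \<i>) = - x" for x by (simp add: complex_eq_iff)
    have "cis t - p = cis t * cnj (1 - cnj w * (cis t * z))"
      using ct by (simp add: p_def algebra_simps)
    then have "(cis t - p)\<^sup>2 = (cis t)\<^sup>2 * cnj ((1 - cnj w * (cis t * z))\<^sup>2)"
      by (simp add: power_mult_distrib)
    then show "1 / \<i> * (h (cis t) / (cis t - p)\<^sup>2 * \<i> * cis t) =
        f (cis t * z) * cnj (bergman_kernel w (cis t * z))"
      using ct ii by (simp add: h_def bergman_kernel_def power2_eq_square)
  qed
  finally have I: "integral {0..2 * pi} (\<lambda>t. f (cis t * z) * cnj (bergman_kernel w (cis t * z))) =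
      2 * pi * deriv h p"
    by (simp add: integral_unique)
  have hk: "bergman_kernel w holomorphic_on unit_disc"
    using bergman_kernel_in_bergman_space[OF w] by (simp add: bergman_space_def)
  have comp: "continuous_on UNIV (\<lambda>t. g (cis t * z))" if "g holomorphic_on unit_disc" for g
    using z by (intro continuous_on_compose2[OF holomorphic_on_imp_continuous_on[OF that]] continuous_intros)
      (auto simp: norm_mult)
  have "continuous_on UNIV (\<lambda>t. f (cis t * z) * cnj (bergman_kernel w (cis t * z)))"
    by (intro continuous_on_mult continuous_on_cnj comp f hk)
  then have "(\<integral>t. f (cis t * z) * cnj (bergman_kernel w (cis t * z)) \<partial>uniform_measure lborel {0..2 * pi}) =
      (1 / (2 * pi - 0)) *\<^sub>R integral {0..2 * pi} (\<lambda>t. f (cis t * z) * cnj (bergman_kernel w (cis t * z)))"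
    by (intro integral_uniform_measure_Icc borel_measurable_continuous_onI)
      (auto intro: continuous_on_subset)
  also have "\<dots> = deriv h p" unfolding I by (simp add: scaleR_conv_of_real)
  finally show ?thesis by (simp only: dh pz)
qed

theorem bergman_inner_kernel:
  assumes f: "f \<in> bergman_space" and w: "w \<in> unit_disc"
  shows "bergman_inner f (bergman_kernel w) = f w"
proof -
  interpret D: prob_space disc_measure by (rule prob_space_disc_measure)
  have hf: "f holomorphic_on unit_disc" and f2: "integrable disc_measure (\<lambda>z. (cmod (f z))\<^sup>2)"
    using f by (auto simp: bergman_space_def)
  have hk: "bergman_kernel w holomorphic_on unit_disc"
    and k2: "integrable disc_measure (\<lambda>z. (cmod (bergman_kernel w z))\<^sup>2)"
    using bergman_kernel_in_bergman_space[OF w] by (auto simp: bergman_space_def)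
  \<comment> \<open>The product of the moduli is dominated by the sum of their squares, since
    \<open>2 * x * y \<le> x\<^sup>2 + y\<^sup>2\<close>.\<close>
  have int: "integrable disc_measure (\<lambda>z. f z * cnj (bergman_kernel w z))"
  proof (rule Bochner_Integration.integrable_bound[OF Bochner_Integration.integrable_add[OF f2 k2]])
    show "(\<lambda>z. f z * cnj (bergman_kernel w z)) \<in> borel_measurable disc_measure"
      by (intro borel_measurable_disc_measure_continuous continuous_intros
          holomorphic_on_imp_continuous_on hf hk)
    have "norm (f z * cnj (bergman_kernel w z)) \<le>
        norm ((cmod (f z))\<^sup>2 + (cmod (bergman_kernel w z))\<^sup>2)" for z
      using sum_squares_bound[of "cmod (f z)" "cmod (bergman_kernel w z)"]
        mult_nonneg_nonneg[of "cmod (f z)" "cmod (bergman_kernel w z)"]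
      unfolding norm_mult complex_mod_cnj real_norm_def by linarith
    then show "AE z in disc_measure. norm (f z * cnj (bergman_kernel w z)) \<le>
        norm ((cmod (f z))\<^sup>2 + (cmod (bergman_kernel w z))\<^sup>2)"
      by simp
  qed
  \<comment> \<open>The derivative of \<open>u * f (u * w)\<close>, cut off outside
    \<open>[0, 1]\<close>: the values of \<open>f\<close> off the disc are arbitrary, and
    \<open>G\<close> has to be measurable on the whole line.\<close>
  define G where "G = (\<lambda>u::real. indicator {0..1} u *\<^sub>R
    (f (of_real u * w) + of_real u * w * deriv f (of_real u * w)))"
  have uw: "of_real u * w \<in> unit_disc" if "u \<in> {0..1}" for u :: real
    using that w by (auto simp: norm_mult intro: le_less_trans[OF mult_left_le_one_le])
  have comp: "continuous_on {0..1} (\<lambda>u::real. g (of_real u * w))" if "g holomorphic_on unit_disc" for g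
    using uw by (intro continuous_on_compose2[OF holomorphic_on_imp_continuous_on[OF that]] continuous_intros) auto
  have cont: "continuous_on {0..1} (\<lambda>u::real. f (of_real u * w) + of_real u * w * deriv f (of_real u * w))"
    by (intro continuous_on_add continuous_on_mult continuous_on_of_real_id continuous_on_const
        comp hf holomorphic_deriv open_ball)
  have G: "G \<in> borel_measurable borel"
    unfolding G_def by (intro borel_measurable_continuous_on_indicator cont) auto
  have vd: "((\<lambda>u. of_real u * f (of_real u * w)) has_vector_derivative G u) (at u within {0..1})"
    if u: "u \<in> {0..1}" for u :: real
  proof -
    have "(f has_field_derivative deriv f (of_real u * w)) (at (of_real u * w))"
      using hf uw[OF u] by (intro holomorphic_derivI[where S = unit_disc]) auto
    then have "((\<lambda>u. u * f (u * w)) has_field_derivative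
        (f (of_real u * w) + of_real u * w * deriv f (of_real u * w))) (at (of_real u))"
      by (auto intro!: derivative_eq_intros DERIV_chain2[where f = f and g = "\<lambda>u. u * w"])
    from has_vector_derivative_real_field[OF this] show ?thesis
      using u by (simp add: G_def)
  qed
  have "bergman_inner f (bergman_kernel w) =
      (\<integral>z. (\<integral>\<theta>. f (cis \<theta> * z) * cnj (bergman_kernel w (cis \<theta> * z)) \<partial>uniform_measure lborel {0..2 * pi}) \<partial>disc_measure)"
    unfolding bergman_inner_def using int by (rule integral_disc_measure_rotation_average)
  also have "\<dots> = (\<integral>z. G ((cmod z)\<^sup>2) \<partial>disc_measure)"
  proof (rule Bochner_Integration.integral_cong)
    fix z assume "z \<in> space disc_measure"
    then have z: "z \<in> unit_disc" by (simp add: space_disc_measure)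
    then have "(cmod z)\<^sup>2 \<in> {0..1}" by (simp add: power_le_one)
    then show "(\<integral>\<theta>. f (cis \<theta> * z) * cnj (bergman_kernel w (cis \<theta> * z)) \<partial>uniform_measure lborel {0..2 * pi}) =
        G ((cmod z)\<^sup>2)"
      unfolding integral_circle_kernel[OF hf w z] by (simp add: G_def)
  qed simp
  also have "\<dots> = integral\<^sup>L (distr disc_measure borel (\<lambda>z. (cmod z)\<^sup>2)) G"
    by (intro integral_distr[symmetric] G borel_measurable_disc_measure_continuous continuous_intros)
  also have "\<dots> = (1 / (1 - 0)) *\<^sub>R integral {0..1} G"
    unfolding distr_disc_measure_cmod_power2
    by (intro integral_uniform_measure_Icc G)
      (auto simp: G_def intro!: continuous_on_cong[THEN iffD1, OF refl _ cont])
  \<comment> \<open>The primitive \<open>u * f (u * w)\<close> vanishes at 0 and equals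
    \<open>f w\<close> at 1.\<close>
  also have "\<dots> = f w"
    using fundamental_theorem_of_calculus[OF _ vd] by (simp add: integral_unique)
  finally show ?thesis .
qed

section \<open>The Berezin range of a rotation as a curve\<close>

text \<open>Splitting off \<open>(1 - t)\<^sup>2\<close> prepares the comparison of moduli along the
  curve, whose numerator has exactly this squared modulus.\<close>

lemma cmod_one_minus_power2:
  fixes \<zeta> :: complex and t :: real
  assumes "cmod \<zeta> = 1"
  shows "(cmod (1 - of_real t * \<zeta>))\<^sup>2 = (1 - t)\<^sup>2 + 2 * t * (1 - Re \<zeta>)"
proof -
  have "(Re \<zeta>)\<^sup>2 + (Im \<zeta>)\<^sup>2 = 1" using assms by (simp add: cmod_power2[symmetric])
  then have "t\<^sup>2 * ((Re \<zeta>)\<^sup>2 + (Im \<zeta>)\<^sup>2) = t\<^sup>2" by simp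
  then show ?thesis unfolding cmod_power2 by (simp add: power2_eq_square algebra_simps)
qed

text \<open>By the reproducing property applied to the kernel itself, its squared norm is its value
  at \<open>w\<close>.\<close>

lemma bergman_norm_kernel:
  assumes "w \<in> unit_disc"
  shows "bergman_norm (bergman_kernel w) = 1 / (1 - (cmod w)\<^sup>2)"
proof -
  have "(cmod w)\<^sup>2 < 1" using assms by (simp add: abs_square_less_1)
  moreover have "cnj w * w = of_real ((cmod w)\<^sup>2)"
    by (simp only: complex_norm_square mult.commute)
  then have "bergman_kernel w w = of_real ((1 / (1 - (cmod w)\<^sup>2))\<^sup>2)"
    unfolding bergman_kernel_def by (simp add: power_divide)
  ultimately show ?thesis
    unfolding bergman_norm_def bergman_inner_kernel[OF bergman_kernel_in_bergman_space[OF assms] assms]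
    by simp
qed

text \<open>Composing the kernel at \<open>w\<close> with the rotation gives the kernel at
  \<open>v = cnj \<zeta> * w\<close>. Its inner product with the kernel at \<open>w\<close> is its
  value at \<open>w\<close>, which depends on \<open>w\<close> only through
  \<open>t = |w|\<^sup>2\<close>.\<close>

lemma berezin_range_rotation:
  assumes \<phi>: "\<And>z. z \<in> unit_disc \<Longrightarrow> \<phi> z = \<zeta> * z" and \<zeta>: "cmod \<zeta> = 1"
  shows "berezin_range (composition_operator \<phi>) =
    (\<lambda>t::real. ((1 - of_real t) / (1 - of_real t * \<zeta>))\<^sup>2) ` {0..<1}"
proof -
  have val: "bergman_inner (composition_operator \<phi> (normalized_kernel w)) (normalized_kernel w) =
      ((1 - of_real ((cmod w)\<^sup>2)) / (1 - of_real ((cmod w)\<^sup>2) * \<zeta>))\<^sup>2"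
    if w: "w \<in> unit_disc" for w
  proof -
    define v where "v = cnj \<zeta> * w"
    define N where "N = complex_of_real (bergman_norm (bergman_kernel w))"
    have v: "v \<in> unit_disc" using w \<zeta> by (simp add: v_def norm_mult)
    have "bergman_inner (composition_operator \<phi> (normalized_kernel w)) (normalized_kernel w) =
        (\<integral>z. (bergman_kernel v z * cnj (bergman_kernel w z)) / N\<^sup>2 \<partial>disc_measure)"
      unfolding bergman_inner_def
      by (intro Bochner_Integration.integral_cong)
        (auto simp: space_disc_measure composition_operator_def \<phi> normalized_kernel_def N_def
          bergman_kernel_def v_def power2_eq_square mult_ac)
    also have "\<dots> = bergman_inner (bergman_kernel v) (bergman_kernel w) / N\<^sup>2"
      unfolding bergman_inner_def by (rule integral_divide_zero)
    also have "\<dots> = bergman_kernel v w / N\<^sup>2"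
      using bergman_inner_kernel[OF bergman_kernel_in_bergman_space[OF v] w] by simp
    also have "bergman_kernel v w = 1 / (1 - of_real ((cmod w)\<^sup>2) * \<zeta>)\<^sup>2"
      unfolding bergman_kernel_def complex_norm_square by (simp add: v_def mult_ac)
    also have "1 / N = 1 - of_real ((cmod w)\<^sup>2)"
      unfolding N_def bergman_norm_kernel[OF w] by simp
    then have "N = 1 / (1 - of_real ((cmod w)\<^sup>2))" by (metis divide_divide_eq_right div_by_1 mult_1)
    finally show ?thesis by (simp add: power_divide)
  qed
  have sq: "(\<lambda>w::complex. (cmod w)\<^sup>2) ` unit_disc = {0..<1}"
  proof (intro equalityI subsetI)
    fix t :: real assume "t \<in> {0..<1}"
    then show "t \<in> (\<lambda>w::complex. (cmod w)\<^sup>2) ` unit_disc"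
      by (intro image_eqI[of _ _ "of_real (sqrt t)"]) auto
  qed (auto simp: abs_square_less_1)
  have "berezin_range (composition_operator \<phi>) =
      (\<lambda>w. ((1 - of_real ((cmod w)\<^sup>2)) / (1 - of_real ((cmod w)\<^sup>2) * \<zeta>))\<^sup>2) ` unit_disc"
    unfolding berezin_range_def Setcompr_eq_image by (rule image_cong[OF refl val])
  also have "\<dots> = (\<lambda>t::real. ((1 - of_real t) / (1 - of_real t * \<zeta>))\<^sup>2) ` ((\<lambda>w. (cmod w)\<^sup>2) ` unit_disc)"
    by (simp add: image_image)
  finally show ?thesis by (simp only: sq)
qed

section \<open>Convexity and non-convexity of the curve\<close>

text \<open>With \<open>c = 2 * (1 - Re \<zeta>) > 0\<close> the modulus is
  \<open>(1 - t)\<^sup>2 / ((1 - t)\<^sup>2 + c * t)\<close>. Cross-multiplying cancels the product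
  of the squares and leaves \<open>(1 - t)\<^sup>2 * s < (1 - s)\<^sup>2 * t\<close>.\<close>

lemma cmod_berezin_curve_strict_antimono:
  fixes \<zeta> :: complex and s t :: real
  assumes \<zeta>: "cmod \<zeta> = 1" "Re \<zeta> < 1" and st: "0 \<le> s" "s < t" "t < 1"
  shows "cmod (((1 - of_real t) / (1 - of_real t * \<zeta>))\<^sup>2) < cmod (((1 - of_real s) / (1 - of_real s * \<zeta>))\<^sup>2)"
proof -
  define c where "c = 2 * (1 - Re \<zeta>)"
  have c: "c > 0" using \<zeta> by (simp add: c_def)
  have val: "cmod (((1 - of_real r) / (1 - of_real r * \<zeta>))\<^sup>2) = (1 - r)\<^sup>2 / ((1 - r)\<^sup>2 + c * r)"
    for r :: real
  proof -
    have "cmod (1 - of_real r) = \<bar>1 - r\<bar>"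
      using norm_of_real[of "1 - r"] by (metis of_real_1 of_real_diff)
    then show ?thesis
      using cmod_one_minus_power2[OF \<zeta>(1), of r]
      by (simp add: norm_power norm_divide power_divide c_def algebra_simps)
  qed
  have pos: "(1 - r)\<^sup>2 + c * r > 0" if "0 \<le> r" "r < 1" for r
    using that c by (intro add_pos_nonneg) auto
  \<comment> \<open>Only weak, as \<open>s\<close> may be 0; strictness comes from then replacing
    the factor \<open>s\<close> by \<open>t\<close>.\<close>
  have "(1 - t)\<^sup>2 * s \<le> (1 - s)\<^sup>2 * s"
    using st by (intro mult_right_mono power_mono) auto
  also have "\<dots> < (1 - s)\<^sup>2 * t" using st by (intro mult_strict_left_mono) auto
  finally have "c * ((1 - t)\<^sup>2 * s) < c * ((1 - s)\<^sup>2 * t)" using c by simp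
  then have "(1 - t)\<^sup>2 * ((1 - s)\<^sup>2 + c * s) < (1 - s)\<^sup>2 * ((1 - t)\<^sup>2 + c * t)"
    by (simp add: algebra_simps)
  then show ?thesis unfolding val using pos[of s] pos[of t] st by (simp add: field_simps)
qed

text \<open>The strictly decreasing norm acts as a coordinate on the curve: convexity puts the chord
  inside the image, and comparing norms tells which curve point a chord point is.\<close>

lemma convex_curve_mem_closed_segment:
  fixes \<gamma> :: "real \<Rightarrow> 'a::real_normed_vector"
  assumes conv: "convex (\<gamma> ` {a..<b})"
    and anti: "\<And>s t. a \<le> s \<Longrightarrow> s < t \<Longrightarrow> t < b \<Longrightarrow> norm (\<gamma> t) < norm (\<gamma> s)"
    and st: "a \<le> s" "s \<le> t" "t < b"
  shows "\<gamma> s \<in> closed_segment (\<gamma> a) (\<gamma> t)"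
proof -
  define p where "p = (\<lambda>u. (1 - u) *\<^sub>R \<gamma> a + u *\<^sub>R \<gamma> t)"
  have le: "norm (\<gamma> y) \<le> norm (\<gamma> x)" if "a \<le> x" "x \<le> y" "y < b" for x y
    using anti[of x y] that by (cases "x = y") auto
  \<comment> \<open>Some point of the chord has the norm of \<open>\<gamma> s\<close>, and the norm determines a point of the curve.\<close>
  have "\<exists>u\<ge>0. u \<le> 1 \<and> norm (p u) = norm (\<gamma> s)"
  \<comment> \<open>The form for decreasing end values: the chord starts at norm at least that of
    \<open>\<gamma> s\<close> and ends at norm at most that.\<close>
  proof (rule IVT2')
    show "continuous_on {0..1} (\<lambda>u. norm (p u))"
      unfolding p_def by (intro continuous_intros)
  qed (use le st in \<open>auto simp: p_def\<close>)
  then obtain u where u: "0 \<le> u" "u \<le> 1" "norm (p u) = norm (\<gamma> s)" by blast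
  have seg: "p u \<in> closed_segment (\<gamma> a) (\<gamma> t)"
    using u by (auto simp: closed_segment_def p_def)
  also have "closed_segment (\<gamma> a) (\<gamma> t) \<subseteq> \<gamma> ` {a..<b}"
    using st by (intro closed_segment_subset conv) auto
  finally obtain r where r: "p u = \<gamma> r" "a \<le> r" "r < b" by auto
  have "r = s"
    using anti[of r s] anti[of s r] u(3) r st by (cases r s rule: linorder_cases) auto
  with r seg show ?thesis by simp
qed

text \<open>The numerator is real and nonzero, so a real value would make the squared denominator
  \<open>d\<^sup>2\<close> real, that is \<open>Re d * Im d = 0\<close>. But
  \<open>Re d = 1 - t * Re \<zeta> > 0\<close> and
  \<open>Im d = - t * Im \<zeta> \<noteq> 0\<close>.\<close>

lemma berezin_curve_nonreal:
  fixes \<zeta> :: complex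
  assumes \<zeta>: "cmod \<zeta> = 1" "Im \<zeta> \<noteq> 0" and t: "0 < t" "t < 1"
  shows "Im (((1 - of_real t) / (1 - of_real t * \<zeta>))\<^sup>2) \<noteq> 0"
proof
  define d where "d = 1 - of_real t * \<zeta>"
  assume "Im (((1 - of_real t) / (1 - of_real t * \<zeta>))\<^sup>2) = 0"
  then have "((1 - of_real t) / d)\<^sup>2 \<in> \<real>" by (simp add: complex_is_Real_iff d_def)
  then have "of_real ((1 - t)\<^sup>2) / ((1 - of_real t) / d)\<^sup>2 \<in> \<real>"
    by (intro Reals_divide) auto
  moreover have "(1 - complex_of_real t) \<noteq> 0" using t by (metis eq_iff_diff_eq_0 less_irrefl of_real_1 of_real_eq_iff)
  ultimately have "d\<^sup>2 \<in> \<real>" by (simp add: power_divide)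
  then have "Re d * Im d = 0" by (auto simp: complex_is_Real_iff power2_eq_square)
  moreover have "t * Re \<zeta> < 1"
    using \<zeta> t abs_Re_le_cmod[of \<zeta>] mult_left_le[of "Re \<zeta>" t] by linarith
  ultimately show False using \<zeta> t by (simp add: d_def)
qed

lemma not_convex_berezin_curve:
  fixes \<zeta> :: complex
  assumes \<zeta>: "cmod \<zeta> = 1" "Im \<zeta> \<noteq> 0"
  shows "\<not> convex ((\<lambda>t::real. ((1 - of_real t) / (1 - of_real t * \<zeta>))\<^sup>2) ` {0..<1})"
proof
  define \<gamma> where "\<gamma> = (\<lambda>t::real. ((1 - of_real t) / (1 - of_real t * \<zeta>))\<^sup>2)"
  assume "convex ((\<lambda>t::real. ((1 - of_real t) / (1 - of_real t * \<zeta>))\<^sup>2) ` {0..<1})"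
  then have conv: "convex (\<gamma> ` {0..<1})" by (simp add: \<gamma>_def)
  have "\<bar>Re \<zeta>\<bar> < 1"
    using \<zeta> cmod_power2[of \<zeta>] by (simp add: abs_square_less_1[symmetric])
      (metis less_add_same_cancel1 zero_less_power2)
  then have re: "Re \<zeta> < 1" by simp
  have anti: "norm (\<gamma> t) < norm (\<gamma> s)" if "0 \<le> s" "s < t" "t < 1" for s t
    unfolding \<gamma>_def using that by (intro cmod_berezin_curve_strict_antimono \<zeta> re)
  \<comment> \<open>Expresses that \<open>\<gamma> (1/2)\<close>, \<open>\<gamma> t\<close> and
    \<open>\<gamma> 0 = 1\<close> are collinear, as an equation that survives the limit. Any
    interior parameter could replace \<open>1/2\<close>.\<close>
  have col: "Im ((\<gamma> (1/2) - 1) * cnj (\<gamma> t - 1)) = 0" if "1/2 \<le> t" "t < 1" for t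
  proof -
    have "\<gamma> (1/2) \<in> closed_segment (\<gamma> 0) (\<gamma> t)"
      using that by (intro convex_curve_mem_closed_segment[OF conv anti]) auto
    then obtain u where "\<gamma> (1/2) = (1 - u) *\<^sub>R 1 + u *\<^sub>R \<gamma> t"
      by (auto simp: closed_segment_def \<gamma>_def)
    then have "\<gamma> (1/2) - 1 = of_real u * (\<gamma> t - 1)"
      by (simp add: scaleR_conv_of_real algebra_simps)
    then show ?thesis by simp
  qed
  \<comment> \<open>The endpoint 1 lies outside the parameter range, but the formula extends
    continuously to it.\<close>
  have "1 - \<zeta> \<noteq> 0" using \<zeta> by auto
  then have "isCont \<gamma> 1" unfolding \<gamma>_def by (intro continuous_intros) auto
  then have lim: "((\<lambda>t. Im ((\<gamma> (1/2) - 1) * cnj (\<gamma> t - 1))) \<longlongrightarrow> Im ((\<gamma> (1/2) - 1) * cnj (\<gamma> 1 - 1))) (at_left 1)"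
    by (intro tendsto_intros) (auto simp: isCont_def intro: filterlim_at_split[THEN iffD1, THEN conjunct1])
  have "\<forall>\<^sub>F t in at_left 1. Im ((\<gamma> (1/2) - 1) * cnj (\<gamma> t - 1)) = 0"
    using eventually_at_left_real[of "1/2" "1::real", simplified]
    by (rule eventually_mono) (rule col; simp)
  with lim have "((\<lambda>_. 0) \<longlongrightarrow> Im ((\<gamma> (1/2) - 1) * cnj (\<gamma> 1 - 1))) (at_left (1::real))"
    by (rule Lim_transform_eventually)
  then have "Im ((\<gamma> (1/2) - 1) * cnj (\<gamma> 1 - 1)) = 0"
    by (metis tendsto_const tendsto_unique trivial_limit_at_left_real)
  \<comment> \<open>The limiting chord runs from 1 to 0, so collinearity puts
    \<open>\<gamma> (1/2)\<close> on the real axis.\<close>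
  moreover have "\<gamma> 1 = 0" by (simp add: \<gamma>_def)
  ultimately have "Im (\<gamma> (1/2)) = 0" by simp
  then show False using berezin_curve_nonreal[OF \<zeta>, of "1/2"] by (simp add: \<gamma>_def)
qed

text \<open>For \<open>\<zeta> = -1\<close> the curve is real: a continuous image of an interval is
  connected, hence convex in the reals, and the embedding into the complex numbers is
  linear.\<close>

lemma convex_berezin_curve_minus_one:
  "convex ((\<lambda>t::real. ((1 - of_real t) / (1 - of_real t * (-1 :: complex)))\<^sup>2) ` {0..<1})"
proof -
  define g where "g = (\<lambda>t::real. ((1 - t) / (1 + t))\<^sup>2)"
  have "continuous_on {0..<1} g" unfolding g_def by (intro continuous_intros) auto
  then have "connected (g ` {0..<1})" by (intro connected_continuous_image) auto
  then have "convex (g ` {0..<1})" by (simp add: is_interval_convex_1[symmetric] is_interval_connected_1)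
  from convex_linear_image[OF bounded_linear.linear[OF bounded_linear_of_real] this]
  have "convex (complex_of_real ` g ` {0..<1})" .
  also have "complex_of_real ` g ` {0..<1} =
      (\<lambda>t::real. ((1 - of_real t) / (1 - of_real t * (-1 :: complex)))\<^sup>2) ` {0..<1}"
    by (simp add: image_image g_def)
  finally show ?thesis .
qed

lemma convex_berezin_curve_one:
  "convex ((\<lambda>t::real. ((1 - of_real t) / (1 - of_real t * (1 :: complex)))\<^sup>2) ` {0..<1})"
proof -
  \<comment> \<open>At \<open>t = 1\<close> the quotient would be \<open>0 / 0 = 0\<close>; the
    half-open interval keeps this second value out.\<close>
  have "((1 - of_real t) / (1 - of_real t * (1 :: complex)))\<^sup>2 = 1" if "t < 1" for t :: real
  proof -
    have "complex_of_real (1 - t) \<noteq> 0" using that by (simp only: of_real_eq_0_iff)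
    then show ?thesis by simp
  qed
  then have "(\<lambda>t::real. ((1 - of_real t) / (1 - of_real t * (1 :: complex)))\<^sup>2) ` {0..<1} = {1}"
    by force
  then show ?thesis by simp
qed

section \<open>The criterion in terms of \<open>a\<close>\<close>

theorem mainTheorem7:
  fixes a b :: complex and \<phi> :: "complex \<Rightarrow> complex"
  assumes "(cmod a)\<^sup>2 - (cmod b)\<^sup>2 = 1"
    and "\<And>z. z \<in> unit_disc \<Longrightarrow> \<phi> z = (a * z + b) / (cnj b * z + cnj a)"
    and "b = 0"
  shows "convex (berezin_range (composition_operator \<phi>)) \<longleftrightarrow> a \<in> {1, -1, \<i>, -\<i>}"
proof -
  have a: "cmod a = 1" using assms(1,3) by (simp add: abs_square_eq_1)
  have aa: "a * cnj a = 1" using a by (simp add: complex_norm_square[symmetric])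
  \<comment> \<open>As \<open>|a| = 1\<close>, \<open>cnj a\<close> is the inverse of
    \<open>a\<close>; the rotation factor is \<open>a\<^sup>2\<close>, and the four values of
    \<open>a\<close> are the square roots of 1 and -1.\<close>
  then have "a / cnj a = a\<^sup>2" by (auto simp: divide_eq_eq power2_eq_square mult.assoc)
  then have \<phi>: "\<phi> z = a\<^sup>2 * z" if "z \<in> unit_disc" for z
    using assms(2)[OF that] assms(3) by (simp add: mult.commute flip: times_divide_eq_left)
  have a2: "cmod (a\<^sup>2) = 1" using a by (simp add: norm_power)
  have range: "berezin_range (composition_operator \<phi>) =
      (\<lambda>t::real. ((1 - of_real t) / (1 - of_real t * a\<^sup>2))\<^sup>2) ` {0..<1}"
    using \<phi> a2 by (rule berezin_range_rotation)
  have "convex (berezin_range (composition_operator \<phi>)) \<longleftrightarrow> a\<^sup>2 = 1 \<or> a\<^sup>2 = -1"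
  proof (cases "Im (a\<^sup>2) = 0")
    case True
    \<comment> \<open>The only real points of the unit circle.\<close>
    then have "Re (a\<^sup>2) = 1 \<or> Re (a\<^sup>2) = -1"
      using a2 cmod_power2[of "a\<^sup>2"] by (simp add: power2_eq_1_iff)
    with True have "a\<^sup>2 = 1 \<or> a\<^sup>2 = -1" by (auto simp: complex_eq_iff)
    moreover from this have "convex (berezin_range (composition_operator \<phi>))"
      unfolding range
      by (elim disjE) (simp_all only: convex_berezin_curve_one convex_berezin_curve_minus_one)
    ultimately show ?thesis by blast
  next
    case False
    then show ?thesis unfolding range using not_convex_berezin_curve[OF a2 False] by auto
  qed
  also have "a\<^sup>2 = -1 \<longleftrightarrow> a = \<i> \<or> a = -\<i>"
    using power2_eq_iff[of a \<i>] by simp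
  finally show ?thesis by (auto simp: power2_eq_1_iff)
qed

end
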